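(* Let $W$ be one of $S_n$ ($n\ge1$), $S^B_n$ ($n\ge1$), $\widetilde{S}_n$ ($n\ge3$), $\widetilde{S}^C_n$ ($n\ge2$), with window size $n$. If $w\in W$ has a reduced word containing a consecutive triple of letters $x\,(x+1)\,x$ or $x\,(x-1)\,x$ for some $x\in[n-1]$, then $\mathrm{dis}(w)/2<\ell_S(w)$.
   Context: - $S_n$: permutations of $[n]$. - $S^B_n$: bijections $w$ of $\{-n,\dots,n\}$ with $w(-i)=-w(i)$. - $\widetilde{S}_n$: bijections $w$ of $\mathbb{Z}$ with $w(i+n)=w(i)+n$ and $\sum_{i=1}^n w(i)=\binom{n+1}{2}$. - $\widetilde{S}^C_n$: bijections $w$ of $\mathbb{Z}$ with $w(-i)=-w(i)$ and $w(2(n+1)-i)=2(n+1)-w(i)$. Generators (each transposition extended by the group's symmetries): $s_i$ swaps $i,i+1$ for $1\le i\le n-1$; in $\widetilde{S}_n$, $s_0=s_n$ swaps $0,1$ (letters $0$ and $n$ denote the same generator); in $S^B_n$ and $\widetilde{S}^C_n$, $s_0$ swaps $-1,1$; in $\widetilde{S}^C_n$, $s_n$ swaps $n,n+2$. $\ell_S(w)$ is the Coxeter length with respect to these generators; a reduced word for $w$ is a word $i_1\cdots i_\ell$ with $w=s_{i_1}\cdots s_{i_\ell}$ and $\ell=\ell_S(w)$. $\mathrm{dis}(w)=\sum_{i=1}^n|w(i)-i|$. *)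

theory Defs
  imports Complex_Main "HOL-Combinatorics.Permutations" "HOL-Number_Theory.Cong"
    "HOL-Library.Sublist"
begin

text \<open>The four families are treated uniformly: every group consists of functions
  \<^typ>\<open>int \<Rightarrow> int\<close>. A bijection of a finite set of integers is represented by the
  function that extends it by the identity (this is what \<^const>\<open>permutes\<close> says).\<close>

datatype family = Sym | SymB | AffSym | AffC

fun min_window :: "family \<Rightarrow> nat" where
  "min_window Sym = 1"
| "min_window SymB = 1"
| "min_window AffSym = 3"
| "min_window AffC = 2"

fun cox_group :: "family \<Rightarrow> nat \<Rightarrow> (int \<Rightarrow> int) set" where
  "cox_group Sym n = {w. w permutes {1..int n}}"
| "cox_group SymB n =
     {w. w permutes {- int n..int n} \<and> (\<forall>i\<in>{- int n..int n}. w (- i) = - w i)}"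
| "cox_group AffSym n =
     {w. bij w \<and> (\<forall>i. w (i + int n) = w i + int n) \<and>
         (\<Sum>i = 1..int n. w i) = int ((n + 1) choose 2)}"
| "cox_group AffC n =
     {w. bij w \<and> (\<forall>i. w (- i) = - w i) \<and>
         (\<forall>i. w (2 * (int n + 1) - i) = 2 * (int n + 1) - w i)}"

text \<open>In the family \<^const>\<open>AffSym\<close> the letters \<open>0\<close> and \<open>n\<close> both occur; they denote the
  same generator (lemma \<open>gen_AffSym_0_n\<close> below).\<close>

fun letters :: "family \<Rightarrow> nat \<Rightarrow> nat set" where
  "letters Sym n = {1..<n}"
| "letters SymB n = {0..<n}"
| "letters AffSym n = {0..n}"
| "letters AffC n = {0..n}"

text \<open>The product of the transpositions \<open>(a + k m, b + k m)\<close> over all integers \<open>k\<close>;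
  it is meant for \<open>a\<close> and \<open>b\<close> in different residue classes modulo \<open>m\<close>.\<close>

definition periodic_transpose :: "int \<Rightarrow> int \<Rightarrow> int \<Rightarrow> int \<Rightarrow> int" where
  "periodic_transpose m a b j =
     (if [j = a] (mod m) then j + (b - a)
      else if [j = b] (mod m) then j - (b - a) else j)"

fun gen :: "family \<Rightarrow> nat \<Rightarrow> nat \<Rightarrow> int \<Rightarrow> int" where
  "gen Sym n i = transpose (int i) (int i + 1)"
| "gen SymB n i =
     (if i = 0 then transpose (- 1) 1
      else transpose (int i) (int i + 1) \<circ> transpose (- int i) (- (int i + 1)))"
| "gen AffSym n i = periodic_transpose (int n) (int i) (int i + 1)"
| "gen AffC n i =
     (let m = 2 * (int n + 1) in
      if i = 0 then periodic_transpose m (- 1) 1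
      else if i = n then periodic_transpose m (int n) (int n + 2)
      else periodic_transpose m (int i) (int i + 1) \<circ>
           periodic_transpose m (- int i) (- (int i + 1)))"

lemma gen_AffSym_0_n: "gen AffSym n 0 = gen AffSym n n"
  by (rule ext) (simp add: periodic_transpose_def cong_def)

text \<open>The word \<open>i\<^sub>1 \<dots> i\<^sub>l\<close> is sent to \<open>s\<^bsub>i\<^sub>1\<^esub> \<circ> \<dots> \<circ> s\<^bsub>i\<^sub>l\<^esub>\<close>, the rightmost factor
  being applied first.\<close>

definition word_prod :: "family \<Rightarrow> nat \<Rightarrow> nat list \<Rightarrow> int \<Rightarrow> int" where
  "word_prod T n u = foldr (\<circ>) (map (gen T n) u) id"

definition cox_length :: "family \<Rightarrow> nat \<Rightarrow> (int \<Rightarrow> int) \<Rightarrow> nat" where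
  "cox_length T n w =
     (LEAST k. \<exists>u. set u \<subseteq> letters T n \<and> word_prod T n u = w \<and> length u = k)"

definition reduced_word :: "family \<Rightarrow> nat \<Rightarrow> nat list \<Rightarrow> (int \<Rightarrow> int) \<Rightarrow> bool" where
  "reduced_word T n u w \<longleftrightarrow>
     set u \<subseteq> letters T n \<and> word_prod T n u = w \<and> length u = cox_length T n w"

definition dis :: "nat \<Rightarrow> (int \<Rightarrow> int) \<Rightarrow> int" where
  "dis n w = (\<Sum>i = 1..int n. \<bar>w i - i\<bar>)"

end

theory Submission
  imports Defs
begin

text \<open>Every family has a set of isometric reflections or translations of \<open>\<int>\<close> with which
  its elements commute, and \<open>\<bar>v j - j\<bar>\<close> is invariant under them.  A group element \<open>g\<close> permutes
  the orbits represented by the window, so \<open>\<bar>v (g i) - i\<bar> \<le> \<bar>v (g i) - g i\<bar> + \<bar>g i - i\<bar>\<close> sums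
  to the subadditivity \<open>dis (v \<circ> g) \<le> dis v + dis g\<close>.  Each generator has displacement at
  most 2, whereas a triple \<open>x (x \<plusminus> 1) x\<close> of three generators has displacement at most 4.\<close>

section \<open>Symmetries, equivariant maps and invariant functions\<close>

fun symmetries :: "family \<Rightarrow> nat \<Rightarrow> (int \<Rightarrow> int) set" where
  "symmetries Sym n = {}"
| "symmetries SymB n = {uminus}"
| "symmetries AffSym n = {\<lambda>i. i + int n}"
| "symmetries AffC n = {uminus, \<lambda>i. 2 * (int n + 1) - i}"

definition equivariant :: "family \<Rightarrow> nat \<Rightarrow> (int \<Rightarrow> int) \<Rightarrow> bool" where
  "equivariant T n v \<longleftrightarrow> (\<forall>s\<in>symmetries T n. \<forall>i. v (s i) = s (v i))"

text \<open>Such an \<open>f\<close> depends only on the orbit of its argument; the case of interest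
  is the pointwise displacement of an equivariant map.\<close>

definition invariant :: "family \<Rightarrow> nat \<Rightarrow> (int \<Rightarrow> int) \<Rightarrow> bool" where
  "invariant T n f \<longleftrightarrow> (\<forall>s\<in>symmetries T n. \<forall>i. f (s i) = f i)"

lemma equivariant_id: "equivariant T n id"
  by (simp add: equivariant_def)

lemma equivariant_comp: "equivariant T n v \<Longrightarrow> equivariant T n g \<Longrightarrow> equivariant T n (v \<circ> g)"
  by (simp add: equivariant_def)

lemma invariant_comp: "invariant T n f \<Longrightarrow> equivariant T n g \<Longrightarrow> invariant T n (f \<circ> g)"
  by (simp add: equivariant_def invariant_def)

lemma symmetries_isometry: "s \<in> symmetries T n \<Longrightarrow> \<bar>s i - s j\<bar> = \<bar>i - j\<bar>"
  by (cases T) auto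

lemma invariant_displacement: "equivariant T n v \<Longrightarrow> invariant T n (\<lambda>j. \<bar>v j - j\<bar>)"
  by (simp add: equivariant_def invariant_def symmetries_isometry)

section \<open>Periodic transpositions and equivariance of the generators\<close>

lemma cong_iff_eq: "\<bar>j - a\<bar> < m \<Longrightarrow> [j = a] (mod m) \<longleftrightarrow> j = (a::int)"
  using dvd_imp_le_int[of "j - a" m] by (auto simp: cong_iff_dvd_diff)

text \<open>Modulo \<open>m\<close> the reflection \<open>c - j\<close> is negation. The values
  \<open>c = 0\<close> and \<open>c = m\<close> give the two symmetries of
  \<open>AffC\<close>.\<close>

lemma periodic_transpose_reflect:
  assumes "m dvd c"
  shows "periodic_transpose m a b (c - j) = c - periodic_transpose m (- a) (- b) j"
proof -
  have "[c - j = x] (mod m) \<longleftrightarrow> [j = - x] (mod m)" for x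
  proof -
    have "m dvd (c - j) - x \<longleftrightarrow> m dvd c - (j - - x)" by (simp add: algebra_simps)
    also have "\<dots> \<longleftrightarrow> m dvd j - - x" using assms by (simp add: dvd_diff_right_iff)
    finally show ?thesis by (simp add: cong_iff_dvd_diff)
  qed
  then show ?thesis by (simp add: periodic_transpose_def)
qed

text \<open>Negation interchanges the classes of \<open>a\<close> and \<open>b\<close>, as for the
  pairs \<open>-1, 1\<close> and \<open>n, n + 2\<close> modulo \<open>2 * (n + 1)\<close>.
  Incongruence makes the order of the two tests irrelevant.\<close>

lemma periodic_transpose_neg:
  assumes "m dvd a + b" "\<not> [a = b] (mod m)"
  shows "periodic_transpose m (- a) (- b) = periodic_transpose m a b"
proof -
  have "[- a = b] (mod m)" "[- b = a] (mod m)"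
    using assms(1) by (auto simp: cong_iff_dvd_diff) (metis add.commute dvd_minus_iff minus_add_distrib uminus_add_conv_diff diff_conv_add_uminus)+
  then have "[j = - a] (mod m) \<longleftrightarrow> [j = b] (mod m)" "[j = - b] (mod m) \<longleftrightarrow> [j = a] (mod m)" for j
    by (auto simp: cong_def)
  then show ?thesis using assms(2) by (auto simp: periodic_transpose_def cong_def)
qed

lemma periodic_transpose_commute:
  assumes "\<not> [a = c] (mod m)" "\<not> [a = d] (mod m)" "\<not> [b = c] (mod m)" "\<not> [b = d] (mod m)"
  shows "periodic_transpose m a b (periodic_transpose m c d j) =
    periodic_transpose m c d (periodic_transpose m a b j)"
proof -
  \<comment> \<open>Each transposition carries one of its classes to the other, so a point moved by
    one is never moved by the other.\<close>
  have *: "[i + (y - x) = y] (mod m)" "[i - (x - y) = y] (mod m)" if "[i = x] (mod m)" for i x y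
    using that by (simp_all add: cong_iff_dvd_diff algebra_simps)
  show ?thesis
    using assms *[of j a b] *[of j b a] *[of j c d] *[of j d c]
    unfolding periodic_transpose_def by (auto simp: cong_def)
qed

lemma equivariant_gen:
  assumes n: "n \<ge> min_window T" and i: "i \<in> letters T n"
  shows "equivariant T n (gen T n i)"
proof (cases T)
  case Sym
  then show ?thesis by (simp add: equivariant_def)
next
  case SymB
  then show ?thesis by (auto simp: equivariant_def transpose_def)
next
  case AffSym
  have "[j + int n = c] (mod int n) \<longleftrightarrow> [j = c] (mod int n)" for j c by (simp add: cong_def)
  then show ?thesis using AffSym by (auto simp: equivariant_def periodic_transpose_def)
next
  case AffC
  define m where "m = 2 * (int n + 1)"
  have i': "i \<le> n" and n': "n \<ge> 2" using i n AffC by auto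
  have "gen AffC n i (c - j) = c - gen AffC n i j" if c: "m dvd c" for c j
  proof -
    note refl = periodic_transpose_reflect[OF c]
    consider "i = 0" | "i = n" | "0 < i" "i < n" using i' by linarith
    then show ?thesis
    proof cases
      case 1
      have "\<not> [- 1 = 1] (mod m)" using n' by (subst cong_iff_eq) (auto simp: m_def)
      then show ?thesis
        using 1 refl[of "- 1" 1] periodic_transpose_neg[of m "- 1" 1] by (simp add: m_def)
    next
      case 2
      have "\<not> [int n = int n + 2] (mod m)" using n' by (subst cong_iff_eq) (auto simp: m_def)
      moreover have "m dvd int n + (int n + 2)" by (simp add: m_def)
      ultimately show ?thesis
        using 2 n' refl[of "int n" "int n + 2"] periodic_transpose_neg[of m "int n" "int n + 2"]
        by (simp add: m_def)
    next
      case 3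
      \<comment> \<open>The reflection turns each factor into the other, and commuting them restores
        the order. The four differences are nonzero and below \<open>m\<close> because
        \<open>0 < i < n\<close>.\<close>
      have "\<not> [int i = - int i] (mod m)" "\<not> [int i = - (int i + 1)] (mod m)"
        "\<not> [int i + 1 = - int i] (mod m)" "\<not> [int i + 1 = - (int i + 1)] (mod m)"
        using 3 by (subst cong_iff_eq; auto simp: m_def)+
      note comm = periodic_transpose_commute[OF this]
      show ?thesis
        using 3 refl[of "int i" "int i + 1"] refl[of "- int i" "- (int i + 1)"]
          comm by (simp add: m_def Let_def add.commute)
    qed
  qed
  from this[of 0] this[of m] show ?thesis using AffC by (simp add: equivariant_def m_def)
qed

section \<open>Words, and the generators on the window\<close>

lemma word_prod_Nil [simp]: "word_prod T n [] = id"
  and word_prod_Cons [simp]: "word_prod T n (i # u) = gen T n i \<circ> word_prod T n u"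
  by (simp_all add: word_prod_def)

lemma word_prod_append: "word_prod T n (u @ v) = word_prod T n u \<circ> word_prod T n v"
  by (induction u) (simp_all add: comp_assoc)

lemma equivariant_word_prod:
  "n \<ge> min_window T \<Longrightarrow> set u \<subseteq> letters T n \<Longrightarrow> equivariant T n (word_prod T n u)"
  by (induction u) (auto intro: equivariant_id equivariant_comp equivariant_gen)

text \<open>The mirrored factor in \<open>SymB\<close> and \<open>AffC\<close> moves only
  \<open>- i\<close>, \<open>- (i + 1)\<close> and, in \<open>AffC\<close>, their translates by
  multiples of \<open>2 * (n + 1)\<close>; none lies in the window.\<close>

lemma gen_inner:
  assumes i: "i \<in> {1..<n}" and j: "j \<in> {1..int n}"
  shows "gen T n i j = transpose (int i) (int i + 1) j"
proof (cases T)
  case AffSym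
  then show ?thesis
    using i j by (auto simp: periodic_transpose_def cong_iff_eq transpose_def Let_def)
next
  case AffC
  then show ?thesis
    using i j by (auto simp: periodic_transpose_def cong_iff_eq transpose_def Let_def)
qed (use i j in \<open>auto simp: transpose_def\<close>)

lemma gen_SymB_0: "j \<in> {1..int n} \<Longrightarrow> gen SymB n 0 j = (if j = 1 then - 1 else j)"
  by (auto simp: transpose_def)

lemma gen_AffC_0: "j \<in> {1..int n} \<Longrightarrow> gen AffC n 0 j = (if j = 1 then - 1 else j)"
  by (auto simp: periodic_transpose_def cong_iff_eq)

lemma gen_AffC_n:
  "n \<ge> 2 \<Longrightarrow> j \<in> {1..int n} \<Longrightarrow> gen AffC n n j = (if j = int n then int n + 2 else j)"
  by (auto simp: periodic_transpose_def cong_iff_eq)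

lemma gen_AffSym_n:
  assumes "n \<ge> 2" "j \<in> {1..int n}"
  shows "gen AffSym n n j = (if j = int n then int n + 1 else if j = 1 then 0 else j)"
proof -
  have "[j = int n + 1] (mod int n) \<longleftrightarrow> [j = 1] (mod int n)" by (simp add: cong_def)
  then show ?thesis using assms by (auto simp: periodic_transpose_def cong_iff_eq)
qed

text \<open>Case \<open>A\<close> records an equality of generators rather than letters, so that the
  letters \<open>0\<close> and \<open>n\<close> of \<open>AffSym\<close> are handled
  together.\<close>

lemma letters_cases:
  assumes "i \<in> letters T n"
  obtains (inner) "i \<in> {1..<n}" | (B0) "T = SymB" "i = 0" | (C0) "T = AffC" "i = 0"
    | (Cn) "T = AffC" "i = n" | (A) "T = AffSym" "gen T n i = gen T n n"
  using assms gen_AffSym_0_n[of n] by (cases T; cases "i = 0"; cases "i = n") auto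

section \<open>Window sums of invariant functions and subadditivity\<close>

lemma sum_gen:
  assumes n: "n \<ge> min_window T" and i: "i \<in> letters T n" and f: "invariant T n f"
  shows "(\<Sum>j = 1..int n. f (gen T n i j)) = (\<Sum>j = 1..int n. f j)"
proof -
  \<comment> \<open>A boundary generator leaves the window; folding its values back along a symmetry
    gives \<open>p\<close>. This is the identity when the generator is a sign change or a reflection
    at \<open>n + 1\<close>, and the swap of \<open>1\<close> and \<open>n\<close> in
    \<open>AffSym\<close>, where \<open>n + 1\<close> folds to \<open>1\<close> and \<open>0\<close>
    to \<open>n\<close>.\<close>
  have "\<exists>p. p permutes {1..int n} \<and> (\<forall>j\<in>{1..int n}. f (gen T n i j) = f (p j))"
    using i
  proof (cases rule: letters_cases)
    case inner
    then show ?thesis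
      by (intro exI[of _ "transpose (int i) (int i + 1)"])
        (auto simp: gen_inner simp del: gen.simps intro!: permutes_swap_id)
  next
    case B0
    then have "f (- 1) = f 1" using f by (simp add: invariant_def)
    with B0 show ?thesis
      by (intro exI[of _ id]) (auto simp: gen_SymB_0 permutes_id simp del: gen.simps)
  next
    case C0
    then have "f (- 1) = f 1" using f by (simp add: invariant_def)
    with C0 show ?thesis
      by (intro exI[of _ id]) (auto simp: gen_AffC_0 permutes_id simp del: gen.simps)
  next
    case Cn
    then have "f (2 * (int n + 1) - j) = f j" for j using f by (simp add: invariant_def)
    from this[of "int n"] have "f (int n + 2) = f (int n)" by (simp add: add.commute)
    with Cn n show ?thesis
      by (intro exI[of _ id]) (auto simp: gen_AffC_n permutes_id simp del: gen.simps)
  next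
    case A
    then have f': "f (j + int n) = f j" for j using f by (simp add: invariant_def)
    have "f (int n + 1) = f 1" "f 0 = f (int n)" using f'[of 1] f'[of 0] by (simp_all add: add.commute)
    with A n show ?thesis
      by (intro exI[of _ "transpose 1 (int n)"])
        (auto simp: gen_AffSym_n transpose_def simp del: gen.simps intro!: permutes_swap_id)
  qed
  then obtain p where p: "p permutes {1..int n}" "\<forall>j\<in>{1..int n}. f (gen T n i j) = f (p j)"
    by blast
  then show ?thesis using sum.permute[OF p(1), of f] by simp
qed

text \<open>The leftmost letter is absorbed into \<open>f\<close>, which stays invariant because
  generators are equivariant; hence the induction varies \<open>f\<close>.\<close>

lemma sum_word_prod:
  assumes "n \<ge> min_window T" "set u \<subseteq> letters T n" "invariant T n f"
  shows "(\<Sum>j = 1..int n. f (word_prod T n u j)) = (\<Sum>j = 1..int n. f j)"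
  using assms(2,3)
proof (induction u arbitrary: f)
  case (Cons i u)
  then have "invariant T n (f \<circ> gen T n i)"
    using assms(1) by (auto intro: invariant_comp equivariant_gen)
  with Cons show ?case using sum_gen[OF assms(1), of i f] Cons.IH[of "f \<circ> gen T n i"]
    by (simp add: comp_def del: gen.simps)
qed simp

text \<open>The two factors play different roles: \<open>v\<close> supplies an invariant
  displacement, while the word permutes the orbits.\<close>

lemma dis_comp_le:
  assumes "n \<ge> min_window T" "equivariant T n v" "set u \<subseteq> letters T n"
  shows "dis n (v \<circ> word_prod T n u) \<le> dis n v + dis n (word_prod T n u)"
proof -
  let ?g = "word_prod T n u"
  have "dis n (v \<circ> ?g) \<le> (\<Sum>j = 1..int n. \<bar>v (?g j) - ?g j\<bar> + \<bar>?g j - j\<bar>)"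
    unfolding dis_def by (rule sum_mono) simp
  also have "\<dots> = dis n v + dis n ?g"
    using sum_word_prod[OF assms(1,3) invariant_displacement[OF assms(2)]]
    by (simp add: dis_def sum.distrib)
  finally show ?thesis .
qed

section \<open>Displacement of generators and of triples\<close>

lemma dis_le_support:
  assumes "finite A" "\<And>j. j \<in> {1..int n} \<Longrightarrow> j \<notin> A \<Longrightarrow> g j = j"
  shows "dis n g \<le> (\<Sum>j\<in>A. \<bar>g j - j\<bar>)"
proof -
  have "dis n g = (\<Sum>j\<in>{1..int n} \<inter> A. \<bar>g j - j\<bar>)"
    unfolding dis_def by (rule sum.mono_neutral_right) (use assms in auto)
  also have "\<dots> \<le> (\<Sum>j\<in>A. \<bar>g j - j\<bar>)" by (rule sum_mono2) (use assms in auto)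
  finally show ?thesis .
qed

text \<open>Either two window points move by 1 each, or a single one (\<open>1\<close> or
  \<open>n\<close>) moves by 2.\<close>

lemma dis_gen:
  assumes n: "n \<ge> min_window T" and i: "i \<in> letters T n"
  shows "dis n (gen T n i) \<le> 2"
  using i
proof (cases rule: letters_cases)
  case inner
  then show ?thesis
    using dis_le_support[of "{int i, int i + 1}" n "gen T n i"]
    by (auto simp: gen_inner transpose_def simp del: gen.simps)
next
  case B0
  then show ?thesis
    using n dis_le_support[of "{1}" n "gen T n i"] by (auto simp: gen_SymB_0 simp del: gen.simps)
next
  case C0
  then show ?thesis
    using n dis_le_support[of "{1}" n "gen T n i"] by (auto simp: gen_AffC_0 simp del: gen.simps)
next
  case Cn
  then show ?thesis
    using n dis_le_support[of "{int n}" n "gen T n i"]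
    by (auto simp: gen_AffC_n simp del: gen.simps)
next
  case A
  then show ?thesis
    using n dis_le_support[of "{1, int n}" n "gen T n i"]
    by (auto simp: gen_AffSym_n simp del: gen.simps)
qed

lemma dis_word_prod:
  assumes "n \<ge> min_window T" "set u \<subseteq> letters T n"
  shows "dis n (word_prod T n u) \<le> 2 * int (length u)"
  using assms(2)
proof (induction u)
  case Nil
  then show ?case by (simp add: dis_def)
next
  case (Cons i u)
  then have "i \<in> letters T n" "set u \<subseteq> letters T n" by auto
  with Cons show ?case
    using dis_comp_le[OF assms(1) equivariant_gen[OF assms(1)], of i u] dis_gen[OF assms(1), of i]
    by (simp add: comp_def del: gen.simps)
qed

text \<open>The triple is a conjugate of \<open>s_y\<close>: it moves either two window points by 2
  each or one by 4, and the intermediate point returns to its place.\<close>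

lemma dis_triple:
  assumes n: "n \<ge> min_window T" and x: "x \<in> {1..<n}" and y: "y \<in> letters T n"
    and xy: "y = x + 1 \<or> x = y + 1"
  shows "dis n (word_prod T n [x, y, x]) \<le> 4"
proof -
  let ?g = "\<lambda>j. gen T n x (gen T n y (gen T n x j))"
  have g: "word_prod T n [x, y, x] = ?g" by (simp add: fun_eq_iff del: gen.simps)
  have xl: "x \<in> letters T n" using x by (cases T) auto
  \<comment> \<open>A boundary \<open>s_y\<close> leaves the window, where \<open>gen_inner\<close>
    is silent; equivariance supplies the values of \<open>s_x\<close> there.\<close>
  note eq = equivariant_gen[OF n xl, unfolded equivariant_def]
  note win = gen_inner[OF x, where T = T]
  have "dis n ?g \<le> 4"
  proof (cases "y \<in> {1..<n}")
    case True
    \<comment> \<open>The triple swaps \<open>?l\<close> and \<open>?l + 2\<close> and fixes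
      \<open>?l + 1\<close>.\<close>
    let ?l = "int (min x y)"
    have "?g j = transpose (int x) (int x + 1) (transpose (int y) (int y + 1)
        (transpose (int x) (int x + 1) j))" if "j \<in> {1..int n}" for j
      using that x True by (auto simp: gen_inner transpose_def simp del: gen.simps)
    then show ?thesis
      using dis_le_support[of "{?l, ?l + 2}" n ?g] x True xy
      by (auto simp: transpose_def min_def simp del: gen.simps split: if_splits)
  next
    case False
    then consider "T = SymB \<or> T = AffC" "y = 0" "x = 1" | "T = AffC" "y = n" "n = x + 1"
      | "T = AffSym" "y = 0" "x = 1" | "T = AffSym" "y = n" "n = x + 1"
      using x y xy by (cases T) auto
    then show ?thesis
    proof cases
      case 1
      \<comment> \<open>The only moved window point travels \<open>2, 1, -1, -2\<close>.\<close>
      have "gen T n x (- 2) = - 1" "gen T n x (- 1) = - 2"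
        using eq 1 x win[of 1] win[of 2] by (auto simp del: gen.simps)
      then show ?thesis
        using dis_le_support[of "{2}" n ?g] x 1
        by (auto simp: gen_inner gen_SymB_0 gen_AffC_0 transpose_def simp del: gen.simps)
    next
      case 2
      have "gen T n x (2 * (int n + 1) - j) = 2 * (int n + 1) - gen T n x j" for j
        using eq 2 by (simp del: gen.simps)
      \<comment> \<open>The only moved window point travels
        \<open>n - 1, n, n + 2, n + 3\<close>.\<close>
      from this[of "int n"] have "gen T n x (int n + 2) = int n + 3"
        using 2 x win[of "int n"] by (simp add: transpose_def algebra_simps del: gen.simps)
      then show ?thesis
        using dis_le_support[of "{int x}" n ?g] x 2
        by (auto simp: gen_inner gen_AffC_n transpose_def simp del: gen.simps)
    next
      case 3
      have "gen T n x (j + int n) = gen T n x j + int n" for j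
        using eq 3 by (simp del: gen.simps)
      \<comment> \<open>The paths are \<open>2, 1, 0, 0\<close> and
        \<open>n, n, n + 1, n + 2\<close>; \<open>n \<ge> 3\<close> separates \<open>n\<close> from
        \<open>2\<close>.\<close>
      from this[of 0] this[of 1]
      have "gen T n x 0 = 0" "gen T n x (int n + 1) = int n + 2"
        using 3 n win[of "int n"] win[of 1] by (auto simp: transpose_def add.commute simp del: gen.simps)
      then show ?thesis
        using dis_le_support[of "{2, int n}" n ?g] x 3 n
        by (auto simp: gen_inner gen_AffSym_0_n gen_AffSym_n transpose_def simp del: gen.simps)
    next
      case 4
      have "gen T n x (j + int n) = gen T n x j + int n" for j
        using eq 4 by (simp del: gen.simps)
      \<comment> \<open>The paths are \<open>n - 1, n, n + 1, n + 1\<close> and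
        \<open>1, 1, 0, -1\<close>; \<open>n \<ge> 3\<close> separates \<open>1\<close> from
        \<open>x\<close>.\<close>
      from this[of 0] this[of 1]
      have "gen T n x 0 = - 1" "gen T n x (int n + 1) = int n + 1"
        using 4 n win[of "int n"] win[of 1] by (auto simp: transpose_def add.commute simp del: gen.simps)
      then show ?thesis
        using dis_le_support[of "{1, int x}" n ?g] x 4 n
        by (auto simp: gen_inner gen_AffSym_n transpose_def simp del: gen.simps)
    qed
  qed
  then show ?thesis by (simp only: g)
qed

theorem theorem3p4:
  fixes T :: family and n :: nat and w :: "int \<Rightarrow> int"
  assumes "n \<ge> min_window T"
    and "w \<in> cox_group T n"
    and "\<exists>u. reduced_word T n u w \<and>
           (\<exists>x\<in>{1..n - 1}. sublist [x, x + 1, x] u \<or> sublist [x, x - 1, x] u)"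
  shows "real_of_int (dis n w) / 2 < real (cox_length T n w)"
proof -
  from assms(3) obtain u x y where u: "reduced_word T n u w" and x: "x \<in> {1..n - 1}"
    and y: "y = x + 1 \<or> y = x - 1" and sub: "sublist [x, y, x] u"
    by blast
  \<comment> \<open>Since \<open>x \<ge> 1\<close>, the natural subtraction \<open>x - 1\<close>
    does not truncate.\<close>
  have xy: "y = x + 1 \<or> x = y + 1" and x': "x \<in> {1..<n}" using x y by auto
  from sub obtain p q where up: "u = p @ [x, y, x] @ q" by (auto simp: sublist_def)
  have lets: "set u \<subseteq> letters T n" and w: "word_prod T n u = w"
    and len: "length u = cox_length T n w"
    using u by (auto simp: reduced_word_def)
  have p: "set p \<subseteq> letters T n" and q: "set q \<subseteq> letters T n"
    and t: "set [x, y, x] \<subseteq> letters T n" and yl: "y \<in> letters T n"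
    using lets up by auto
  note n = assms(1)
  let ?P = "word_prod T n p" and ?M = "word_prod T n [x, y, x]" and ?Q = "word_prod T n q"
  have "w = (?P \<circ> ?M) \<circ> ?Q" using w unfolding up word_prod_append by (simp only: comp_assoc)
  then have "dis n w \<le> dis n (?P \<circ> ?M) + dis n ?Q"
    using dis_comp_le[OF n _ q] equivariant_comp equivariant_word_prod[OF n] p t by blast
  also have "dis n (?P \<circ> ?M) \<le> dis n ?P + dis n ?M"
    using dis_comp_le[OF n equivariant_word_prod[OF n p] t] .
  \<comment> \<open>The triple contributes 4 where three separate letters would allow 6; this gap
    makes the inequality strict.\<close>
  finally have "dis n w \<le> 2 * int (length p) + 4 + 2 * int (length q)"
    using dis_word_prod[OF n p] dis_word_prod[OF n q] dis_triple[OF n x' yl xy] by linarith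
  then have "dis n w < 2 * int (cox_length T n w)" using len up by simp
  then show ?thesis by linarith
qed

end
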